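(* Let $\mathcal X$ be a finite metric space with metric $d$ taking values in $\{0,1,\dots,n\}$, where $n=\operatorname{diam}(\mathcal X)$ is a positive integer, and assume $\mathcal X$ is distance-invariant, i.e. the cardinality of the metric ball $B(x,t)=\{y\in\mathcal X: d(x,y)\le t\}$ does not depend on the center $x$. Let $Z=\{z_1,\dots,z_N\}\subset\mathcal X$ be an $N$-point subset. Then $$D^{L_2}(Z)=\frac12\Big(\frac1{|\mathcal X|^2}\sum_{x,y\in\mathcal X}\sum_{u\in\mathcal X}|d(x,u)-d(y,u)|-\frac1{N^2}\sum_{i,j=1}^N\sum_{u\in\mathcal X}|d(z_i,u)-d(z_j,u)|\Big).$$
   Context: The quadratic discrepancy of $Z$ is $D^{L_2}(Z)=\sum_{t=0}^n D_t(Z)^2$, where $$D_t(Z)=\Big(\sum_{x\in\mathcal X}\Big(\frac1N\sum_{j=1}^N\mathbb 1_{B(x,t)}(z_j)-\frac{|B(x,t)|}{|\mathcal X|}\Big)^2\Big)^{1/2},$$ and $\mathbb 1_{B(x,t)}$ is the indicator function of the ball $B(x,t)$. *)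

theory Defs
  imports "HOL-Analysis.Analysis"
begin

context Metric_space
begin

text \<open>The carrier-set counterpart of \<^const>\<open>diameter\<close>, which is tied to the type class.\<close>

definition mdiameter :: real where
  "mdiameter = (if M = {} then 0 else SUP (x, y)\<in>M \<times> M. d x y)"

definition distance_invariant :: bool where
  "distance_invariant \<longleftrightarrow>
    (\<forall>t. \<forall>x\<in>M. \<forall>y\<in>M. card (mcball x t) = card (mcball y t))"

definition discrepancy_at :: "real \<Rightarrow> 'a set \<Rightarrow> real" where
  "discrepancy_at t Z =
    sqrt (\<Sum>x\<in>M. (1 / real (card Z) * (\<Sum>z\<in>Z. indicator (mcball x t) z)
                    - real (card (mcball x t)) / real (card M))\<^sup>2)"

text \<open>The parameter \<open>n\<close> is the diameter of the space, as a natural number.\<close>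

definition quadratic_discrepancy :: "nat \<Rightarrow> 'a set \<Rightarrow> real" where
  "quadratic_discrepancy n Z = (\<Sum>t=0..n. (discrepancy_at (real t) Z)\<^sup>2)"

end

end

theory Submission
  imports Defs
begin

text \<open>
  For a finite nonempty set \<open>A\<close> let \<open>m\<^sub>A(u,t)\<close> be the proportion of points of \<open>A\<close> in the ball
  \<open>B(u,t)\<close>. As distances are integers in \<open>{0..n}\<close>, the number \<open>\<bar>d x u - d y u\<bar>\<close> counts the radii
  \<open>t\<close> for which exactly one of \<open>x\<close>, \<open>y\<close> lies in \<open>B(u,t)\<close>; hence half the average of
  \<open>\<Sum>u. \<bar>d x u - d y u\<bar>\<close> over \<open>A \<times> A\<close> is the sum over \<open>t\<close> and \<open>u\<close> of the Bernoulli variances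
  \<open>m\<^sub>A(u,t) - m\<^sub>A(u,t)\<^sup>2\<close>. Distance invariance makes \<open>m\<^sub>X(u,t)\<close> independent of \<open>u\<close> and, by double
  counting, equal to the mean over \<open>u\<close> of \<open>m\<^sub>Z(u,t)\<close>. So the linear terms cancel in the difference
  of the two energies, which becomes
  \<open>\<Sum>t u. m\<^sub>Z(u,t)\<^sup>2 - m\<^sub>X(u,t)\<^sup>2 = \<Sum>t u. (m\<^sub>Z(u,t) - m\<^sub>X(u,t))\<^sup>2\<close>.
\<close>

text \<open>The pairwise form of the variance: for nonempty finite \<open>A\<close>, division by
  \<open>2 * (card A)\<^sup>2\<close> turns the right side into mean square minus squared mean. It
  serves for indicators of balls.\<close>

lemma sum_sum_power2_diff:
  fixes f :: "'a \<Rightarrow> real"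
  shows "(\<Sum>x\<in>A. \<Sum>y\<in>A. (f x - f y)\<^sup>2) = 2 * real (card A) * (\<Sum>x\<in>A. (f x)\<^sup>2) - 2 * (\<Sum>x\<in>A. f x)\<^sup>2"
proof -
  have "(\<Sum>x\<in>A. \<Sum>y\<in>A. (f x - f y)\<^sup>2)
      = (\<Sum>x\<in>A. \<Sum>y\<in>A. (f x)\<^sup>2 + (f y)\<^sup>2 - 2 * (f x * f y))"
    by (simp add: power2_diff mult.assoc)
  also have "\<dots> = 2 * real (card A) * (\<Sum>x\<in>A. (f x)\<^sup>2) - 2 * (\<Sum>x\<in>A. \<Sum>y\<in>A. f x * f y)"
    by (simp add: sum.distrib sum_subtractf flip: sum_distrib_left)
  also have "(\<Sum>x\<in>A. \<Sum>y\<in>A. f x * f y) = (\<Sum>x\<in>A. f x)\<^sup>2"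
    by (simp add: power2_eq_square sum_product)
  finally show ?thesis .
qed

lemma abs_diff_eq_sum_of_bool:
  fixes a b n :: nat
  assumes "a \<le> n" "b \<le> n"
  shows "\<bar>real a - real b\<bar> = (\<Sum>t=0..n. (of_bool (a \<le> t) - of_bool (b \<le> t))\<^sup>2)"
proof -
  \<comment> \<open>The truth values differ exactly when \<open>min a b \<le> t < max a b\<close>;
    at \<open>t = max a b\<close> both hold, hence the half-open interval.\<close>
  have "(\<Sum>t=0..n. (of_bool (a \<le> t) - of_bool (b \<le> t))\<^sup>2 :: real)
      = (\<Sum>t=0..n. if t \<in> {min a b..<max a b} then 1 else 0)"
    by (intro sum.cong) auto
  also have "\<dots> = real (card ({0..n} \<inter> {min a b..<max a b}))"
    by (subst sum.inter_restrict[symmetric]) simp_all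
  also have "{0..n} \<inter> {min a b..<max a b} = {min a b..<max a b}"
    using assms by auto
  finally show ?thesis by (auto simp: min_def max_def)
qed

context Metric_space
begin

definition ball_share :: "'a set \<Rightarrow> 'a \<Rightarrow> real \<Rightarrow> real" where
  "ball_share A u t = 1 / real (card A) * (\<Sum>x\<in>A. indicator (mcball u t) x)"

lemma abs_dist_diff_eq_sum_indicator:
  assumes int: "\<forall>x\<in>M. \<forall>y\<in>M. d x y \<in> real ` {0..n}"
    and "x \<in> M" "y \<in> M" "u \<in> M"
  shows "\<bar>d x u - d y u\<bar>
    = (\<Sum>t=0..n. (indicator (mcball u (real t)) x - indicator (mcball u (real t)) y)\<^sup>2)"
proof -
  have "d x u \<in> real ` {0..n}" "d y u \<in> real ` {0..n}"
    using int assms(2-4) by blast+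
  then obtain a b where ab: "d x u = real a" "a \<le> n" "d y u = real b" "b \<le> n"
    by auto
  have "indicator (mcball u (real t)) x = (of_bool (a \<le> t) :: real)"
       "indicator (mcball u (real t)) y = (of_bool (b \<le> t) :: real)" for t
    using ab assms(2-4) by (auto simp: indicator_def commute)
  then show ?thesis
    using abs_diff_eq_sum_of_bool[OF ab(2,4)] ab by simp
qed

lemma energy_eq_sum_variance:
  assumes int: "\<forall>x\<in>M. \<forall>y\<in>M. d x y \<in> real ` {0..n}"
    and A: "A \<subseteq> M" "finite A" "A \<noteq> {}"
  shows "1 / 2 * (1 / (real (card A))\<^sup>2 * (\<Sum>x\<in>A. \<Sum>y\<in>A. \<Sum>u\<in>M. \<bar>d x u - d y u\<bar>))
    = (\<Sum>t=0..n. \<Sum>u\<in>M. ball_share A u (real t) - (ball_share A u (real t))\<^sup>2)"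
proof -
  define f :: "nat \<Rightarrow> 'a \<Rightarrow> 'a \<Rightarrow> real" where "f t u = indicator (mcball u (real t))" for t u
  have card: "real (card A) \<noteq> 0" using A by simp
  have var: "1 / 2 * (1 / (real (card A))\<^sup>2 * (\<Sum>x\<in>A. \<Sum>y\<in>A. (f t u x - f t u y)\<^sup>2))
      = ball_share A u t - (ball_share A u t)\<^sup>2" for t u
  proof -
    \<comment> \<open>Indicators are idempotent, so the mean square is the mean and the variance
      takes the Bernoulli form \<open>p - p\<^sup>2\<close>.\<close>
    have sq: "(f t u x)\<^sup>2 = f t u x" for x by (simp add: f_def indicator_def)
    show ?thesis
      unfolding sum_sum_power2_diff sq ball_share_def f_def[symmetric]
      using card by (simp add: field_simps power2_eq_square)
  qed
  \<comment> \<open>Once each distance difference is a sum over radii, the swaps bring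
    \<open>t\<close> and \<open>u\<close> outside, so that \<open>var\<close> applies to each pair
    separately.\<close>
  have "(\<Sum>x\<in>A. \<Sum>y\<in>A. \<Sum>u\<in>M. \<bar>d x u - d y u\<bar>)
      = (\<Sum>x\<in>A. \<Sum>y\<in>A. \<Sum>u\<in>M. \<Sum>t=0..n. (f t u x - f t u y)\<^sup>2)"
    unfolding f_def
    by (intro sum.cong refl abs_dist_diff_eq_sum_indicator[OF int]) (use A in auto)
  also have "\<dots> = (\<Sum>x\<in>A. \<Sum>y\<in>A. \<Sum>t=0..n. \<Sum>u\<in>M. (f t u x - f t u y)\<^sup>2)"
    by (intro sum.cong refl sum.swap)
  also have "\<dots> = (\<Sum>x\<in>A. \<Sum>t=0..n. \<Sum>y\<in>A. \<Sum>u\<in>M. (f t u x - f t u y)\<^sup>2)"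
    by (intro sum.cong refl sum.swap)
  also have "\<dots> = (\<Sum>t=0..n. \<Sum>x\<in>A. \<Sum>y\<in>A. \<Sum>u\<in>M. (f t u x - f t u y)\<^sup>2)"
    by (rule sum.swap)
  also have "\<dots> = (\<Sum>t=0..n. \<Sum>x\<in>A. \<Sum>u\<in>M. \<Sum>y\<in>A. (f t u x - f t u y)\<^sup>2)"
    by (intro sum.cong refl sum.swap)
  also have "\<dots> = (\<Sum>t=0..n. \<Sum>u\<in>M. \<Sum>x\<in>A. \<Sum>y\<in>A. (f t u x - f t u y)\<^sup>2)"
    by (intro sum.cong refl sum.swap)
  finally have "1 / 2 * (1 / (real (card A))\<^sup>2 * (\<Sum>x\<in>A. \<Sum>y\<in>A. \<Sum>u\<in>M. \<bar>d x u - d y u\<bar>))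
      = (\<Sum>t=0..n. \<Sum>u\<in>M.
          1 / 2 * (1 / (real (card A))\<^sup>2 * (\<Sum>x\<in>A. \<Sum>y\<in>A. (f t u x - f t u y)\<^sup>2)))"
    by (simp only: sum_distrib_left)
  then show ?thesis by (simp only: var)
qed

lemma sum_indicator_mcball_eq_card:
  assumes "finite M"
  shows "(\<Sum>x\<in>M. indicator (mcball u t) x) = real (card (mcball u t))"
proof -
  have "{x \<in> M. x \<in> mcball u t} = mcball u t" by auto
  then show ?thesis
    using sum_mult_indicator[OF assms, of "\<lambda>_. 1 :: real" "\<lambda>_. mcball u t" "\<lambda>x. x"]
    by (simp del: in_mcball)
qed

lemma ball_share_space:
  assumes "finite M"
  shows "ball_share M u t = real (card (mcball u t)) / real (card M)"
  using sum_indicator_mcball_eq_card[OF assms] by (simp add: ball_share_def)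

text \<open>Double counting: by symmetry of \<open>d\<close>, \<open>x\<close> lies in the ball
  around \<open>u\<close> iff \<open>u\<close> lies in the ball around \<open>x\<close>. Summing
  over \<open>u\<close> first, each point of \<open>A\<close> contributes the common ball size, and
  \<open>1 / card A\<close> averages these equal terms.\<close>

lemma sum_ball_share_eq_card:
  assumes "finite M" distance_invariant and A: "A \<subseteq> M" "A \<noteq> {}" and "v \<in> M"
  shows "(\<Sum>u\<in>M. ball_share A u t) = real (card (mcball v t))"
proof -
  have fin: "finite A" using assms finite_subset by blast
  have "(\<Sum>u\<in>M. \<Sum>x\<in>A. indicator (mcball u t) x)
      = (\<Sum>x\<in>A. \<Sum>u\<in>M. indicator (mcball u t) x :: real)"
    by (rule sum.swap)
  also have "\<dots> = (\<Sum>x\<in>A. \<Sum>u\<in>M. indicator (mcball x t) u)"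
    using A by (intro sum.cong refl) (auto simp: indicator_def commute)
  also have "\<dots> = (\<Sum>x\<in>A. real (card (mcball v t)))"
    unfolding sum_indicator_mcball_eq_card[OF assms(1)]
  proof (rule sum.cong[OF refl])
    fix x assume "x \<in> A"
    then have "x \<in> M" using A by blast
    then have "card (mcball x t) = card (mcball v t)"
      using assms(2,5) unfolding distance_invariant_def by blast
    then show "real (card (mcball x t)) = real (card (mcball v t))" by (rule arg_cong)
  qed
  finally show ?thesis
    using fin A by (simp add: ball_share_def flip: sum_divide_distrib)
qed

lemma discrepancy_at_power2:
  assumes "finite M" distance_invariant and A: "A \<subseteq> M" "A \<noteq> {}"
  shows "(discrepancy_at t A)\<^sup>2
    = (\<Sum>u\<in>M. ball_share M u t - (ball_share M u t)\<^sup>2) - (\<Sum>u\<in>M. ball_share A u t - (ball_share A u t)\<^sup>2)"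
proof -
  obtain v where v: "v \<in> M" using A by auto
  define b where "b = ball_share M v t"
  have b: "ball_share M u t = b" if "u \<in> M" for u
    using assms that v unfolding b_def ball_share_space[OF assms(1)] distance_invariant_def
    by metis
  have cM: "real (card M) \<noteq> 0" using assms(1) v by auto
  have s: "(\<Sum>u\<in>M. ball_share A u t) = real (card M) * b"
    unfolding sum_ball_share_eq_card[OF assms v] b_def ball_share_space[OF assms(1)]
    using cM by simp
  have "(discrepancy_at t A)\<^sup>2 = (\<Sum>u\<in>M. (ball_share A u t - ball_share M u t)\<^sup>2)"
    unfolding discrepancy_at_def ball_share_space[OF assms(1)] ball_share_def[of A]
    by (intro real_sqrt_pow2 sum_nonneg) auto
  \<comment> \<open>Since \<open>b\<close> is independent of \<open>u\<close>, the cross term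
    involves only the sum of the shares, which \<open>s\<close> evaluates.\<close>
  also have "\<dots> = (\<Sum>u\<in>M. (ball_share A u t)\<^sup>2 + b\<^sup>2 - 2 * b * ball_share A u t)"
    by (intro sum.cong) (simp_all add: b power2_diff)
  also have "\<dots> = (\<Sum>u\<in>M. (ball_share A u t)\<^sup>2) + card M * b\<^sup>2 - 2 * b * (card M * b)"
    by (simp only: sum.distrib sum_subtractf sum_constant s flip: sum_distrib_left)
  \<comment> \<open>The linear parts of the two sums both equal \<open>card M * b\<close>, so
    inserting them changes nothing.\<close>
  also have "\<dots> = (\<Sum>u\<in>M. b - b\<^sup>2) - (\<Sum>u\<in>M. ball_share A u t - (ball_share A u t)\<^sup>2)"
    by (simp add: sum_subtractf s algebra_simps power2_eq_square)
  also have "(\<Sum>u\<in>M. b - b\<^sup>2) = (\<Sum>u\<in>M. ball_share M u t - (ball_share M u t)\<^sup>2)"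
    by (intro sum.cong) (simp_all add: b)
  finally show ?thesis .
qed

end

theorem theorem2p1:
  fixes X :: "'a set" and d :: "'a \<Rightarrow> 'a \<Rightarrow> real" and n N :: nat
    and Z :: "'a set" and z :: "nat \<Rightarrow> 'a"
  assumes metric: "Metric_space X d"
    and finite: "finite X"
    and int_valued: "\<forall>x\<in>X. \<forall>y\<in>X. d x y \<in> real ` {0..n}"
    and diam: "real n = Metric_space.mdiameter X d"
    and n_pos: "0 < n"
    and invariant: "Metric_space.distance_invariant X d"
    and Z_subset: "Z \<subseteq> X"
    and Z_enum: "bij_betw z {1..N} Z"
    and N_pos: "0 < N"
  shows "Metric_space.quadratic_discrepancy X d n Z =
    1 / 2 * (1 / (real (card X))\<^sup>2 * (\<Sum>x\<in>X. \<Sum>y\<in>X. \<Sum>u\<in>X. \<bar>d x u - d y u\<bar>)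
           - 1 / (real N)\<^sup>2 * (\<Sum>i=1..N. \<Sum>j=1..N. \<Sum>u\<in>X. \<bar>d (z i) u - d (z j) u\<bar>))"
proof -
  interpret Metric_space X d by (rule metric)
  have card_Z: "card Z = N" using bij_betw_same_card[OF Z_enum] by simp
  then have Z: "finite Z" "Z \<noteq> {}" using N_pos by (auto intro: card_ge_0_finite)
  then have X: "X \<noteq> {}" using Z_subset by auto
  have reindex: "(\<Sum>i=1..N. \<Sum>j=1..N. \<Sum>u\<in>X. \<bar>d (z i) u - d (z j) u\<bar>)
      = (\<Sum>x\<in>Z. \<Sum>y\<in>Z. \<Sum>u\<in>X. \<bar>d x u - d y u\<bar>)"
    by (subst sum.reindex_bij_betw[OF Z_enum, symmetric], intro sum.cong refl,
        subst sum.reindex_bij_betw[OF Z_enum, symmetric], rule refl)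
  have "quadratic_discrepancy n Z
      = (\<Sum>t=0..n. \<Sum>u\<in>X. ball_share X u t - (ball_share X u t)\<^sup>2)
        - (\<Sum>t=0..n. \<Sum>u\<in>X. ball_share Z u t - (ball_share Z u t)\<^sup>2)"
    unfolding quadratic_discrepancy_def discrepancy_at_power2[OF finite invariant Z_subset Z(2)]
    by (rule sum_subtractf)
  \<comment> \<open>The energy identity is read from right to left, with \<open>A = X\<close> and
    with \<open>A = Z\<close>.\<close>
  then show ?thesis
    unfolding energy_eq_sum_variance[OF int_valued subset_refl finite X, symmetric]
      energy_eq_sum_variance[OF int_valued Z_subset Z, symmetric] reindex card_Z
    by (simp only: right_diff_distrib)
qed

end
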